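(* Let $n\ge 1$ be a square-free integer with $n\neq 3$, let $\Gamma_n'=\mathrm{PSL}_2(\mathcal{O}_{-n})$ be the $n$-th Bianchi group, and let $\widetilde m\colon \mathrm{PSL}_2(\mathbb{C})\to\{-1,0,1\}$ be the symbol $$\widetilde m(g)=\begin{cases}1&\text{if } g\cdot j\in\widetilde\Sigma^+,\\ -1&\text{if } g\cdot j\in\widetilde\Sigma^-,\\ 0&\text{otherwise.}\end{cases}$$ Then $\widetilde m$ satisfies the Cotlar identity on $\Gamma_n'$ (relative to $\widetilde K_n=\{g\in\Gamma_n'\colon \widetilde m(g)=0\}$), that is, $$(\widetilde m(g^{-1})-\widetilde m(h))\,(\widetilde m(gh)-\widetilde m(g))=0\qquad\text{for all } g\in\Gamma_n'\setminus\widetilde K_n,\ h\in\Gamma_n'.$$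
   Context: $\mathcal{O}_{-n}$ is the ring of integers of $\mathbb{Q}(\sqrt{-n})$: $\mathcal{O}_{-n}=\mathbb{Z}[\sqrt{-n}]$ if $n\not\equiv -1\pmod 4$, and $\mathcal{O}_{-n}=\mathbb{Z}[\tfrac{1+\sqrt{-n}}{2}]$ otherwise. $\mathrm{PSL}_2(R)=\mathrm{SL}_2(R)/\{\pm I\}$. Hyperbolic 3-space is $\mathbb{H}^3=\{z+rj: z\in\mathbb{C},\ r>0\}$, a subset of the quaternions with units $i,j,k$. $\mathrm{PSL}_2(\mathbb{C})$ acts on it by $g\cdot\omega=(a\omega+b)(c\omega+d)^{-1}$ for $g=\begin{bmatrix}a&b\\c&d\end{bmatrix}$. For $\omega=z+rj$, $\mathrm{Im}(\omega)$ means $\mathrm{Im}(z)$, and $\widetilde\Sigma^+=\{\omega\in\mathbb{H}^3:\mathrm{Im}(\omega)>0\}$, $\widetilde\Sigma^-=\{\omega\in\mathbb{H}^3:\mathrm{Im}(\omega)<0\}$. Explicitly, $\widetilde m(g)=\mathrm{sign}(\mathrm{Im}(a\overline{c}+b\overline{d}))$ with $\mathrm{sign}(0)=0$. *)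

theory Defs
  imports
    "HOL-Analysis.Analysis"
    "HOL-Algebra.Coset"
    "HOL-Computational_Algebra.Polynomial"
    "HOL-Computational_Algebra.Squarefree"
begin

section \<open>The ring of integers of an imaginary quadratic field\<close>

definition sqrt_neg :: "nat \<Rightarrow> complex" where
  "sqrt_neg n = \<i> * of_real (sqrt (real n))"

definition imag_quadratic_field :: "nat \<Rightarrow> complex set" where
  "imag_quadratic_field n = {of_rat p + of_rat q * sqrt_neg n | p q. True}"

text \<open>
  The explicit \<open>\<int>\<close>-bases for square-free \<open>n\<close> are derived below
  (\<open>ring_of_integers_eq\<close>).
\<close>
definition ring_of_integers :: "nat \<Rightarrow> complex set" where
  "ring_of_integers n = {x \<in> imag_quadratic_field n. algebraic_int x}"

lemma sqrt_neg_square: "sqrt_neg n * sqrt_neg n = - of_nat n"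
proof -
  have "complex_of_real (sqrt (real n)) * of_real (sqrt (real n)) = of_nat n"
    by (metis of_real_mult of_real_of_nat_eq of_nat_0_le_iff real_sqrt_mult_self abs_of_nat)
  then show ?thesis
    unfolding sqrt_neg_def by (simp add: algebra_simps)
qed

lemma Re_sqrt_neg [simp]: "Re (sqrt_neg n) = 0"
  and Im_sqrt_neg [simp]: "Im (sqrt_neg n) = sqrt (real n)"
  by (simp_all add: sqrt_neg_def)

definition sqrt_order :: "nat \<Rightarrow> complex set" where
  "sqrt_order n = {of_int a + of_int b * sqrt_neg n | a b. True}"

lemma sqrt_orderI [intro]: "x = of_int a + of_int b * sqrt_neg n \<Longrightarrow> x \<in> sqrt_order n"
  by (auto simp: sqrt_order_def)

lemma sqrt_order_of_int [simp]: "of_int a \<in> sqrt_order n"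
  by (rule sqrt_orderI[of _ a 0]) simp

lemma sqrt_order_add:
  assumes "x \<in> sqrt_order n" "y \<in> sqrt_order n"
  shows "x + y \<in> sqrt_order n"
proof -
  obtain a b c d where "x = of_int a + of_int b * sqrt_neg n" "y = of_int c + of_int d * sqrt_neg n"
    using assms by (auto simp: sqrt_order_def)
  then have "x + y = of_int (a + c) + of_int (b + d) * sqrt_neg n"
    by (simp add: algebra_simps)
  then show ?thesis ..
qed

lemma sqrt_order_mult:
  assumes "x \<in> sqrt_order n" "y \<in> sqrt_order n"
  shows "x * y \<in> sqrt_order n"
proof -
  obtain a b c d where xy: "x = of_int a + of_int b * sqrt_neg n" "y = of_int c + of_int d * sqrt_neg n"
    using assms by (auto simp: sqrt_order_def)
  have "x * y = of_int a * of_int c + of_int b * of_int d * (sqrt_neg n * sqrt_neg n)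
      + (of_int a * of_int d + of_int b * of_int c) * sqrt_neg n"
    unfolding xy by (simp add: algebra_simps)
  also have "\<dots> = of_int (a * c - b * d * int n) + of_int (a * d + b * c) * sqrt_neg n"
    by (simp add: sqrt_neg_square)
  finally show ?thesis ..
qed

lemma sqrt_order_uminus: "x \<in> sqrt_order n \<Longrightarrow> - x \<in> sqrt_order n"
  using sqrt_order_mult[OF sqrt_order_of_int[of "- 1"], of x n] by simp

lemma sqrt_order_power: "x \<in> sqrt_order n \<Longrightarrow> x ^ k \<in> sqrt_order n"
  using sqrt_order_of_int[of 1 n] by (induction k) (auto intro: sqrt_order_mult)

lemma sqrt_order_sum: "(\<And>i. i \<in> I \<Longrightarrow> f i \<in> sqrt_order n) \<Longrightarrow> sum f I \<in> sqrt_order n"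
  using sqrt_order_of_int[of 0 n] by (induction I rule: infinite_finite_induct) (auto intro: sqrt_order_add)

lemma rat_bounded_denominator_imp_int:
  fixes t :: rat
  assumes "M \<noteq> 0" and bd: "\<And>k::nat. of_int M * t ^ k \<in> \<int>"
  shows "t \<in> \<int>"
proof -
  obtain p q where t: "t = of_int p / of_int q" and q: "q > 0" and cop: "coprime p q"
    by (metis Fract_of_int_quotient Rat_cases)
  have "q ^ k dvd M" for k
  proof -
    obtain z where "of_int M * t ^ k = of_int z"
      using bd[of k] by (auto elim: Ints_cases)
    then have "of_int (M * p ^ k) = (of_int (z * q ^ k) :: rat)"
      using q by (simp add: t field_simps)
    then have "M * p ^ k = z * q ^ k"
      by (simp only: of_int_eq_iff)
    then have "q ^ k dvd M * p ^ k" by simp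
    moreover have "coprime (q ^ k) (p ^ k)"
      using cop by (simp add: coprime_commute)
    ultimately show ?thesis
      using coprime_dvd_mult_left_iff by blast
  qed
  note dvd = this
  have "q = 1"
  proof (rule ccontr)
    assume "q \<noteq> 1"
    with q have q2: "2 \<le> q" by simp
    let ?k = "nat \<bar>M\<bar>"
    have "q ^ ?k \<le> \<bar>M\<bar>"
      using dvd[of ?k] \<open>M \<noteq> 0\<close> by (meson dvd_abs_iff zdvd_imp_le zero_less_abs_iff)
    moreover have "int ?k < 2 ^ ?k"
      by (metis of_nat_less_two_power)
    moreover have "(2::int) ^ ?k \<le> q ^ ?k"
      using q2 by (intro power_mono) auto
    ultimately show False by simp
  qed
  then show ?thesis by (simp add: t)
qed

lemma algebraic_int_bounded_denominator:
  assumes x: "x = of_rat p + of_rat q * sqrt_neg n" and "algebraic_int x"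
  obtains N :: int where "N > 0" "\<And>k. of_int N * x ^ k \<in> sqrt_order n"
proof -
  obtain P :: "complex poly" where P: "\<forall>i. coeff P i \<in> \<int>" "lead_coeff P = 1" "poly P x = 0"
    using \<open>algebraic_int x\<close> by (auto elim: algebraic_int.cases)
  define d where "d = degree P"
  obtain a b c e where pq: "p = of_int a / of_int b" "b > 0" "q = of_int c / of_int e" "e > 0"
    by (metis Fract_of_int_quotient Rat_cases)
  define D where "D = b * e"
  have D: "D > 0" by (simp add: D_def pq)
  have "of_int D * x = of_int (a * e) + of_int (c * b) * sqrt_neg n"
    using pq(2,4) by (simp add: x D_def pq(1,3) of_rat_divide field_simps)
  then have Dx: "of_int D * x \<in> sqrt_order n" ..
  have "of_int (D ^ d) * x ^ k \<in> sqrt_order n" for k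
  proof (induction k rule: less_induct)
    case (less k)
    show ?case
    proof (cases "k < d")
      case True
      then have "of_int (D ^ d) * x ^ k = of_int (D ^ (d - k)) * (of_int D * x) ^ k"
        by (simp add: power_mult_distrib flip: power_add mult.assoc)
      then show ?thesis
        using sqrt_order_mult[OF sqrt_order_of_int sqrt_order_power[OF Dx]] by metis
    next
      case False
      have "(\<Sum>i\<le>d. coeff P i * x ^ i) = 0"
        using P(3) by (simp add: poly_altdef d_def)
      then have "(\<Sum>i<d. coeff P i * x ^ i) + x ^ d = 0"
        using P(2) by (simp add: d_def flip: lessThan_Suc_atMost)
      then have "x ^ d = - (\<Sum>i<d. coeff P i * x ^ i)"
        by (simp add: eq_neg_iff_add_eq_0 add.commute)
      then have "x ^ (k - d) * x ^ d = x ^ (k - d) * - (\<Sum>i<d. coeff P i * x ^ i)"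
        by simp
      moreover have "x ^ (k - d) * x ^ d = x ^ k"
        using False by (simp flip: power_add)
      moreover have "x ^ (k - d) * - (\<Sum>i<d. coeff P i * x ^ i)
          = - (\<Sum>i<d. coeff P i * x ^ (k - d + i))"
        by (simp add: sum_distrib_left power_add mult_ac)
      ultimately have "x ^ k = - (\<Sum>i<d. coeff P i * x ^ (k - d + i))" by metis
      then have eq: "of_int (D ^ d) * x ^ k
          = - (\<Sum>i<d. coeff P i * (of_int (D ^ d) * x ^ (k - d + i)))"
        by (simp only: sum_distrib_left mult_ac mult_minus_right)
      have "coeff P i * (of_int (D ^ d) * x ^ (k - d + i)) \<in> sqrt_order n" if "i < d" for i
      proof -
        have "coeff P i \<in> sqrt_order n"
          using P(1) by (metis Ints_cases sqrt_order_of_int)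
        moreover have "of_int (D ^ d) * x ^ (k - d + i) \<in> sqrt_order n"
          using that False by (intro less.IH) linarith
        ultimately show ?thesis by (rule sqrt_order_mult)
      qed
      then show ?thesis
        unfolding eq by (intro sqrt_order_uminus sqrt_order_sum) auto
    qed
  qed
  with D show ?thesis by (intro that[of "D ^ d"]) auto
qed

lemma norm_int_of_bounded_denominator:
  assumes x: "x = of_rat p + of_rat q * sqrt_neg n"
    and N: "N > 0" "\<And>k. of_int N * x ^ k \<in> sqrt_order n"
  shows "p\<^sup>2 + of_nat n * q\<^sup>2 \<in> \<int>"
proof (rule rat_bounded_denominator_imp_int)
  show "N\<^sup>2 \<noteq> 0" using N(1) by simp
  fix k
  obtain u v where uv: "of_int N * x ^ k = of_int u + of_int v * sqrt_neg n"
    using N(2)[of k] by (auto simp: sqrt_order_def)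
  have nrm: "(cmod x)\<^sup>2 = of_rat (p\<^sup>2 + of_nat n * q\<^sup>2)"
  proof -
    have re: "Re (of_rat r) = of_rat r" "Im (of_rat r) = 0" for r :: rat
      by (cases r; simp add: Fract_of_int_quotient of_rat_divide)+
    show ?thesis
      by (simp add: cmod_power2 x re of_rat_add of_rat_mult of_rat_power power_mult_distrib)
  qed
  have "(cmod (of_int N * x ^ k))\<^sup>2 = of_int (u\<^sup>2 + int n * v\<^sup>2)"
    unfolding uv by (simp add: cmod_power2 power_mult_distrib)
  moreover have "(cmod (of_int N * x ^ k))\<^sup>2 = (of_int N)\<^sup>2 * ((cmod x)\<^sup>2) ^ k"
    by (simp add: norm_mult norm_power power_mult_distrib flip: power_mult) (simp add: mult.commute)
  ultimately have "(of_rat (of_int (N\<^sup>2) * (p\<^sup>2 + of_nat n * q\<^sup>2) ^ k) :: real)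
      = of_rat (of_int (u\<^sup>2 + int n * v\<^sup>2))"
    unfolding nrm by (simp add: of_rat_mult of_rat_power of_rat_add)
  then have "of_int (N\<^sup>2) * (p\<^sup>2 + of_nat n * q\<^sup>2) ^ k = (of_int (u\<^sup>2 + int n * v\<^sup>2) :: rat)"
    by (simp only: of_rat_eq_iff)
  then show "of_int (N\<^sup>2) * (p\<^sup>2 + of_nat n * q\<^sup>2) ^ k \<in> \<int>"
    by (metis Ints_of_int)
qed

lemma norm_trace_int:
  assumes x: "x = of_rat p + of_rat q * sqrt_neg n" and "algebraic_int x"
  shows "p\<^sup>2 + of_nat n * q\<^sup>2 \<in> \<int>" "2 * p \<in> \<int>"
proof -
  obtain N where N: "N > 0" "\<And>k. of_int N * x ^ k \<in> sqrt_order n"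
    using algebraic_int_bounded_denominator[OF assms] by blast
  show A: "p\<^sup>2 + of_nat n * q\<^sup>2 \<in> \<int>"
    using norm_int_of_bounded_denominator[OF x N] .
  have x1: "x + 1 = of_rat (p + 1) + of_rat q * sqrt_neg n"
    by (simp add: x of_rat_add)
  have "of_int N * (x + 1) ^ k \<in> sqrt_order n" for k
  proof -
    have "of_int N * (x + 1) ^ k = (\<Sum>i\<le>k. of_int (int (k choose i)) * (of_int N * x ^ i))"
      by (simp add: binomial_ring sum_distrib_left mult_ac)
    then show ?thesis
      by (metis (no_types, lifting) N(2) sqrt_order_mult sqrt_order_of_int sqrt_order_sum)
  qed
  from norm_int_of_bounded_denominator[OF x1 N(1) this]
  have "(p + 1)\<^sup>2 + of_nat n * q\<^sup>2 \<in> \<int>" .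
  from Ints_diff[OF Ints_diff[OF this A] Ints_1] show "2 * p \<in> \<int>"
    by (simp add: power2_eq_square algebra_simps)
qed

lemma squarefree_mult_square_int:
  fixes t :: rat
  assumes "squarefree n" "of_nat n * t\<^sup>2 \<in> \<int>"
  shows "t \<in> \<int>"
proof -
  obtain p q where t: "t = of_int p / of_int q" and q: "q > 0" and cop: "coprime p q"
    by (metis Fract_of_int_quotient Rat_cases)
  obtain z where "of_nat n * t\<^sup>2 = of_int z"
    using assms(2) by (auto elim: Ints_cases)
  then have "of_int (int n * p\<^sup>2) = (of_int (z * q\<^sup>2) :: rat)"
    using q by (simp add: t field_simps)
  then have "int n * p\<^sup>2 = z * q\<^sup>2"
    by (simp only: of_int_eq_iff)
  then have "q\<^sup>2 dvd int n * p\<^sup>2" by simp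
  moreover have "coprime (q\<^sup>2) (p\<^sup>2)"
    using cop by (simp add: coprime_commute)
  ultimately have "q\<^sup>2 dvd int n"
    using coprime_dvd_mult_left_iff by blast
  then have "(nat q)\<^sup>2 dvd n"
    using q by (metis int_dvd_int_iff int_nat_eq of_nat_power order_less_imp_le)
  then have "nat q = 1"
    using assms(1) by (auto simp: squarefree_def)
  with q have "q = 1" by simp
  then show ?thesis by (simp add: t)
qed

lemma algebraic_int_quadratic:
  fixes x :: complex
  assumes "x * x + of_int a * x + of_int b = 0"
  shows "algebraic_int x"
proof (rule algebraic_int.intros)
  let ?p = "[:of_int b, of_int a, 1:] :: complex poly"
  show "lead_coeff ?p = 1" by simp
  show "\<forall>i. coeff ?p i \<in> \<int>"
    by (auto simp: coeff_pCons split: nat.split)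
  show "poly ?p x = 0"
    using assms by (simp add: algebra_simps)
qed

theorem ring_of_integers_eq:
  assumes sqf: "squarefree n"
  shows "ring_of_integers n =
    (if n mod 4 = 3 then {of_int a + of_int b * ((1 + sqrt_neg n) / 2) | a b. True}
     else {of_int a + of_int b * sqrt_neg n | a b. True})" (is "_ = ?R")
proof (intro equalityI subsetI)
  fix x assume "x \<in> ring_of_integers n"
  then obtain p q where x: "x = of_rat p + of_rat q * sqrt_neg n" and ai: "algebraic_int x"
    by (auto simp: ring_of_integers_def imag_quadratic_field_def)
  note nt = norm_trace_int[OF x ai]
  obtain a where a: "2 * p = of_int a" using nt(2) by (auto elim: Ints_cases)
  obtain c where c: "p\<^sup>2 + of_nat n * q\<^sup>2 = of_int c" using nt(1) by (auto elim: Ints_cases)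
  have "of_nat n * (2 * q)\<^sup>2 = 4 * (p\<^sup>2 + of_nat n * q\<^sup>2) - (2 * p)\<^sup>2"
    by (simp add: power2_eq_square algebra_simps)
  also have "\<dots> = of_int (4 * c - a\<^sup>2)" by (simp add: a c)
  finally have nq: "of_nat n * (2 * q)\<^sup>2 = (of_int (4 * c - a\<^sup>2) :: rat)" .
  have "2 * q \<in> \<int>"
    by (rule squarefree_mult_square_int[OF sqf]) (simp only: nq Ints_of_int)
  then obtain b where b: "2 * q = of_int b" by (auto elim: Ints_cases)
  have "(of_int (int n * b\<^sup>2) :: rat) = of_int (4 * c - a\<^sup>2)"
    using nq by (simp add: b)
  then have eq: "int n * b\<^sup>2 = 4 * c - a\<^sup>2" by (simp only: of_int_eq_iff)
  have p: "p = of_int a / 2" and q: "q = of_int b / 2" using a b by auto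
  have x': "2 * x = of_int a + of_int b * sqrt_neg n"
    by (simp add: x p q of_rat_divide algebra_simps)
  have par: "a\<^sup>2 + int n * b\<^sup>2 = 4 * c" using eq by simp
  have sq4: "y\<^sup>2 mod 4 = (if even y then 0 else 1)" for y :: int
  proof (cases "even y")
    case True
    then obtain z where "y = 2 * z" by (auto elim: evenE)
    then show ?thesis by (simp add: power2_eq_square)
  next
    case False
    then obtain z where "y = 2 * z + 1" by (auto elim: oddE)
    then have "y\<^sup>2 = 4 * (z * z + z) + 1" by (simp add: power2_eq_square algebra_simps)
    then have "y\<^sup>2 mod 4 = 1" by presburger
    with False show ?thesis by simp
  qed
  have md: "((if even a then 0 else 1) + (int n mod 4) * (if even b then 0 else 1)) mod 4 = (0::int)"
  proof -
    have "(a\<^sup>2 mod 4 + (int n mod 4) * (b\<^sup>2 mod 4)) mod 4 = (a\<^sup>2 + int n * b\<^sup>2) mod 4"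
      by (subst (2) mod_add_eq[symmetric], subst mod_mult_eq[symmetric], simp only: mod_add_right_eq)
    also have "\<dots> = 0" by (simp add: par)
    finally show ?thesis by (simp only: sq4)
  qed
  have n0: "n mod 4 \<noteq> 0"
  proof
    assume "n mod 4 = 0"
    then have "2\<^sup>2 dvd n" by auto
    with sqf have "is_unit (2::nat)" unfolding squarefree_def by blast
    then show False by simp
  qed
  have nm: "int n mod 4 = int (n mod 4)" by (simp add: zmod_int)
  show "x \<in> ?R"
  proof (cases "n mod 4 = 3")
    case True
    with md have "even a \<longleftrightarrow> even b" by (auto simp: nm split: if_splits)
    then have "even (a - b)" by simp
    then obtain e where "a - b = 2 * e" by (rule evenE)
    then have "a = 2 * e + b" by simp
    then have "of_int a = (2 * of_int e + of_int b :: complex)" by simp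
    with x' have "x = of_int e + of_int b * ((1 + sqrt_neg n) / 2)"
      by (simp add: field_simps)
    with True show ?thesis by auto
  next
    case False
    have "n mod 4 = 1 \<or> n mod 4 = 2" using n0 False by linarith
    with md have "even a" "even b" by (auto simp: nm split: if_splits)
    then obtain a' b' where "a = 2 * a'" "b = 2 * b'" by (auto elim!: evenE)
    with x' have "2 * x = 2 * (of_int a' + of_int b' * sqrt_neg n)" by (simp add: algebra_simps)
    then have "x = of_int a' + of_int b' * sqrt_neg n" by (simp only: mult_cancel_left) simp
    with False show ?thesis by auto
  qed
next
  fix x assume xR: "x \<in> ?R"
  show "x \<in> ring_of_integers n"
  proof (cases "n mod 4 = 3")
    case True
    with xR obtain a b where x: "x = of_int a + of_int b * ((1 + sqrt_neg n) / 2)" by auto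
    define m where "m = int (n div 4) + 1"
    have nm: "(of_nat n :: complex) = 4 * of_int m - 1"
    proof -
      have "int n = 4 * m - 1" using True unfolding m_def by presburger
      then have "(of_int (int n) :: complex) = of_int (4 * m - 1)" by (simp only:)
      then show ?thesis by simp
    qed
    define s where "s = sqrt_neg n"
    have s: "s * s = 1 - 4 * of_int m" by (simp add: s_def sqrt_neg_square nm)
    have "x * x + of_int (- (2 * a + b)) * x + of_int (a\<^sup>2 + a * b + b\<^sup>2 * m)
      = of_int b * of_int b * (s * s - 1 + 4 * of_int m) / 4"
      by (simp add: x power2_eq_square field_simps flip: s_def)
    also have "\<dots> = 0" by (simp add: s)
    finally have "algebraic_int x" by (rule algebraic_int_quadratic)
    moreover have "x = of_rat (of_int a + of_int b / 2) + of_rat (of_int b / 2) * sqrt_neg n"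
      by (simp add: x of_rat_add of_rat_divide) (simp add: field_simps)
    ultimately show ?thesis
      unfolding ring_of_integers_def imag_quadratic_field_def by blast
  next
    case False
    with xR obtain a b where x: "x = of_int a + of_int b * sqrt_neg n" by auto
    define s where "s = sqrt_neg n"
    have s: "s * s = - of_nat n" by (simp add: s_def sqrt_neg_square)
    have "x * x + of_int (- (2 * a)) * x + of_int (a\<^sup>2 + int n * b\<^sup>2)
      = of_int b * of_int b * (s * s + of_nat n)"
      by (simp add: x power2_eq_square algebra_simps flip: s_def)
    also have "\<dots> = 0" by (simp add: s)
    finally have "algebraic_int x" by (rule algebraic_int_quadratic)
    moreover have "x = of_rat (of_int a) + of_rat (of_int b) * sqrt_neg n"
      by (simp add: x)
    ultimately show ?thesis
      unfolding ring_of_integers_def imag_quadratic_field_def by blast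
  qed
qed

section \<open>Special and projective special linear groups\<close>

definition SL2 :: "'a::comm_ring_1 set \<Rightarrow> ('a^2^2) monoid" where
  "SL2 R = \<lparr>carrier = {A. (\<forall>i j. A $ i $ j \<in> R) \<and> det A = 1}, mult = (**), one = mat 1\<rparr>"

text \<open>
  Elements are the cosets \<open>{A, - A}\<close>.  The normal subgroup does not depend on \<open>R\<close>, so
  \<open>PSL2 R\<close> is literally a subset of \<open>PSL2 UNIV\<close>, with the same operations.
\<close>
definition PSL2 :: "'a::comm_ring_1 set \<Rightarrow> ('a^2^2) set monoid" where
  "PSL2 R = SL2 R Mod {mat 1, - mat 1}"

definition bianchi_group :: "nat \<Rightarrow> (complex^2^2) set monoid" where
  "bianchi_group n = PSL2 (ring_of_integers n)"

section \<open>Quaternions\<close>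

text \<open>The quaternion \<open>a + b i + c j + d k\<close>, with \<open>i j = k\<close>.\<close>
datatype quat = Quat (q_re: real) (q_i: real) (q_j: real) (q_k: real)

lemma quat_eqI:
  "q_re x = q_re y \<Longrightarrow> q_i x = q_i y \<Longrightarrow> q_j x = q_j y \<Longrightarrow> q_k x = q_k y \<Longrightarrow> x = y"
  by (rule quat.expand) simp

instantiation quat :: division_ring
begin

definition "0 = Quat 0 0 0 0"
definition "1 = Quat 1 0 0 0"
definition "x + y = Quat (q_re x + q_re y) (q_i x + q_i y) (q_j x + q_j y) (q_k x + q_k y)"
definition "- x = Quat (- q_re x) (- q_i x) (- q_j x) (- q_k x)"
definition "x - y = Quat (q_re x - q_re y) (q_i x - q_i y) (q_j x - q_j y) (q_k x - q_k y)"
definition "x * y = Quat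
  (q_re x * q_re y - q_i x * q_i y - q_j x * q_j y - q_k x * q_k y)
  (q_re x * q_i y + q_i x * q_re y + q_j x * q_k y - q_k x * q_j y)
  (q_re x * q_j y - q_i x * q_k y + q_j x * q_re y + q_k x * q_i y)
  (q_re x * q_k y + q_i x * q_j y - q_j x * q_i y + q_k x * q_re y)"
definition "inverse x = (let N = (q_re x)\<^sup>2 + (q_i x)\<^sup>2 + (q_j x)\<^sup>2 + (q_k x)\<^sup>2
  in Quat (q_re x / N) (- q_i x / N) (- q_j x / N) (- q_k x / N))"
text \<open>Division is multiplication by the inverse from the right.\<close>
definition "x div y = x * inverse y" for x y :: quat

lemmas quat_defs = zero_quat_def one_quat_def plus_quat_def uminus_quat_def minus_quat_def
  times_quat_def

lemma quat_mult_inverse: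
  fixes x :: quat
  assumes "x \<noteq> 0"
  shows "x * inverse x = 1" "inverse x * x = 1"
proof -
  define N where "N = (q_re x)\<^sup>2 + (q_i x)\<^sup>2 + (q_j x)\<^sup>2 + (q_k x)\<^sup>2"
  have N: "N \<noteq> 0"
  proof
    assume "N = 0"
    then have "q_re x = 0 \<and> q_i x = 0 \<and> q_j x = 0 \<and> q_k x = 0"
      unfolding N_def by (simp add: add_nonneg_eq_0_iff)
    with assms show False by (auto simp: quat_defs intro!: quat_eqI)
  qed
  have inv: "inverse x = Quat (q_re x / N) (- q_i x / N) (- q_j x / N) (- q_k x / N)"
    by (simp add: inverse_quat_def N_def Let_def)
  have NN: "q_re x * q_re x + q_i x * q_i x + q_j x * q_j x + q_k x * q_k x = N"
    by (simp add: N_def power2_eq_square)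
  have re: "q_re x * q_re x / N + q_i x * q_i x / N + q_j x * q_j x / N + q_k x * q_k x / N = 1"
    using N NN by (metis add_divide_distrib divide_self)
  show "x * inverse x = 1" "inverse x * x = 1"
    using re by (simp_all add: quat_defs inv algebra_simps)
qed

instance
proof
  fix x y z :: quat
  show "x + y + z = x + (y + z)" "x + y = y + x" "0 + x = x" "- x + x = 0" "x - y = x + - y"
    "1 * x = x" "x * 1 = x" "(0::quat) \<noteq> 1"
    by (auto simp: quat_defs intro!: quat_eqI)
  show "x * y * z = x * (y * z)" "(x + y) * z = x * z + y * z" "x * (y + z) = x * y + x * z"
    by (simp_all add: quat_defs algebra_simps)
  show "x \<noteq> 0 \<Longrightarrow> inverse x * x = 1" "x \<noteq> 0 \<Longrightarrow> x * inverse x = 1"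
    by (fact quat_mult_inverse)+
  show "x div y = x * inverse y" by (fact divide_quat_def)
  show "inverse (0::quat) = 0" by (simp add: inverse_quat_def zero_quat_def)
qed

end

definition quat_of_complex :: "complex \<Rightarrow> quat" where
  "quat_of_complex z = Quat (Re z) (Im z) 0 0"

definition quat_j :: quat where
  "quat_j = Quat 0 0 1 0"

section \<open>Hyperbolic 3-space and the symbol\<close>

definition hyp3 :: "quat set" where
  "hyp3 = {quat_of_complex z + quat_of_complex (of_real r) * quat_j | z r. r > 0}"

text \<open>For \<open>\<omega> = z + r j\<close> the imaginary part of \<open>z\<close> is the \<open>i\<close>-component of \<open>\<omega>\<close>.\<close>
definition Sigma_plus :: "quat set" where
  "Sigma_plus = {\<omega> \<in> hyp3. q_i \<omega> > 0}"

definition Sigma_minus :: "quat set" where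
  "Sigma_minus = {\<omega> \<in> hyp3. q_i \<omega> < 0}"

definition moebius :: "complex^2^2 \<Rightarrow> quat \<Rightarrow> quat" where
  "moebius A \<omega> = (quat_of_complex (A $ 1 $ 1) * \<omega> + quat_of_complex (A $ 1 $ 2)) /
                 (quat_of_complex (A $ 2 $ 1) * \<omega> + quat_of_complex (A $ 2 $ 2))"

text \<open>
  The common value of \<open>moebius\<close> on the two representatives; see \<open>psl_act_coset\<close> below.
\<close>
definition psl_act :: "(complex^2^2) set \<Rightarrow> quat \<Rightarrow> quat" where
  "psl_act g \<omega> = the_elem ((\<lambda>A. moebius A \<omega>) ` g)"

definition m_tilde :: "(complex^2^2) set \<Rightarrow> int" where
  "m_tilde g = (if psl_act g quat_j \<in> Sigma_plus then 1
                else if psl_act g quat_j \<in> Sigma_minus then - 1 else 0)"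

definition K_tilde :: "nat \<Rightarrow> (complex^2^2) set set" where
  "K_tilde n = {g \<in> carrier (bianchi_group n). m_tilde g = 0}"

section \<open>Well-definedness and the explicit formula for the symbol\<close>

lemma moebius_uminus: "moebius (- A) \<omega> = moebius A \<omega>"
proof -
  have neg: "quat_of_complex (- z) = - quat_of_complex z" for z
    by (simp add: quat_of_complex_def uminus_quat_def)
  have "(- x) / (- y) = x / y" for x y :: quat
    by (cases "y = 0") (simp_all add: divide_inverse nonzero_inverse_minus_eq)
  from this[of "quat_of_complex (A $ 1 $ 1) * \<omega> + quat_of_complex (A $ 1 $ 2)"
      "quat_of_complex (A $ 2 $ 1) * \<omega> + quat_of_complex (A $ 2 $ 2)"]
  show ?thesis
    by (simp add: moebius_def neg)
qed

lemma psl_act_coset: "psl_act {A, - A} \<omega> = moebius A \<omega>"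
  by (simp add: psl_act_def moebius_uminus)

lemma matrix_uminus_mult [simp]: "(- A) ** B = - (A ** B)" "A ** (- B) = - (A ** B)"
  for A B :: "'a::comm_ring_1^2^2"
  by (simp_all add: matrix_matrix_mult_def vec_eq_iff sum_negf)

lemma SL2_r_coset: "{mat 1, - mat 1} #>\<^bsub>SL2 R\<^esub> A = {A, - A}"
  by (auto simp: r_coset_def SL2_def)

lemma carrier_PSL2: "carrier (PSL2 R) = (\<lambda>A. {A, - A}) ` carrier (SL2 R)"
  by (simp add: PSL2_def carrier_FactGroup SL2_r_coset)

lemma PSL2_mult: "{A, - A} \<otimes>\<^bsub>PSL2 R\<^esub> {B, - B} = {A ** B, - (A ** B)}"
  by (auto simp: PSL2_def set_mult_def SL2_def)

definition adj2 :: "'a::comm_ring_1^2^2 \<Rightarrow> 'a^2^2" where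
  "adj2 A = vector [vector [A $ 2 $ 2, - A $ 1 $ 2], vector [- A $ 2 $ 1, A $ 1 $ 1]]"

lemma SL2_group:
  fixes R :: "'a::comm_ring_1 set"
  assumes R: "0 \<in> R" "1 \<in> R" "\<And>x y. x \<in> R \<Longrightarrow> y \<in> R \<Longrightarrow> x + y \<in> R"
    "\<And>x y. x \<in> R \<Longrightarrow> y \<in> R \<Longrightarrow> x * y \<in> R" "\<And>x. x \<in> R \<Longrightarrow> - x \<in> R"
  shows "group (SL2 R)"
proof (rule groupI)
  fix A B C assume A: "A \<in> carrier (SL2 R)" and B: "B \<in> carrier (SL2 R)"
  show "A \<otimes>\<^bsub>SL2 R\<^esub> B \<in> carrier (SL2 R)"
    using A B by (auto simp: SL2_def det_mul) (simp add: matrix_matrix_mult_def sum_2 R)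
  show "A \<otimes>\<^bsub>SL2 R\<^esub> B \<otimes>\<^bsub>SL2 R\<^esub> C = A \<otimes>\<^bsub>SL2 R\<^esub> (B \<otimes>\<^bsub>SL2 R\<^esub> C)"
    by (simp add: SL2_def matrix_mul_assoc)
next
  show "\<one>\<^bsub>SL2 R\<^esub> \<in> carrier (SL2 R)"
    by (auto simp: SL2_def mat_def det_2 R)
next
  fix A assume A: "A \<in> carrier (SL2 R)"
  show "\<one>\<^bsub>SL2 R\<^esub> \<otimes>\<^bsub>SL2 R\<^esub> A = A" by (simp add: SL2_def)
  have "adj2 A \<in> carrier (SL2 R)"
    using A by (auto simp: SL2_def adj2_def det_2 forall_2 R algebra_simps)
  moreover have "adj2 A \<otimes>\<^bsub>SL2 R\<^esub> A = \<one>\<^bsub>SL2 R\<^esub>"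
    using A by (auto simp: SL2_def adj2_def det_2 vec_eq_iff matrix_matrix_mult_def sum_2 forall_2
        mat_def algebra_simps)
  ultimately show "\<exists>B\<in>carrier (SL2 R). B \<otimes>\<^bsub>SL2 R\<^esub> A = \<one>\<^bsub>SL2 R\<^esub>" ..
qed

lemma PSL2_group:
  fixes R :: "'a::comm_ring_1 set"
  assumes R: "0 \<in> R" "1 \<in> R" "\<And>x y. x \<in> R \<Longrightarrow> y \<in> R \<Longrightarrow> x + y \<in> R"
    "\<And>x y. x \<in> R \<Longrightarrow> y \<in> R \<Longrightarrow> x * y \<in> R" "\<And>x. x \<in> R \<Longrightarrow> - x \<in> R"
  shows "group (PSL2 R)"
proof -
  interpret group "SL2 R" by (rule SL2_group[OF R])
  have sub: "subgroup {mat 1, - mat 1} (SL2 R)"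
  proof (rule subgroupI)
    show "{mat 1, - mat 1} \<subseteq> carrier (SL2 R)"
      by (auto simp: SL2_def mat_def det_2 R)
    then have "mat 1 \<in> carrier (SL2 R)" "- mat 1 \<in> carrier (SL2 R)" by auto
    then have "inv\<^bsub>SL2 R\<^esub> (mat 1) = mat 1" "inv\<^bsub>SL2 R\<^esub> (- mat 1) = - mat 1"
      by (intro inv_equality; simp add: SL2_def)+
    then show "a \<in> {mat 1, - mat 1} \<Longrightarrow> inv\<^bsub>SL2 R\<^esub> a \<in> {mat 1, - mat 1}" for a
      by auto
  qed (auto simp: SL2_def)
  have "{mat 1, - mat 1} \<lhd> SL2 R"
    unfolding normal_def normal_axioms_def using sub group_axioms
    by (auto simp: r_coset_def l_coset_def SL2_def)
  then show ?thesis
    unfolding PSL2_def by (rule normal.factorgroup_is_group)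
qed

lemma bianchi_group_group:
  assumes "squarefree n"
  shows "group (bianchi_group n)"
proof -
  define w where "w = (if n mod 4 = 3 then (1 + sqrt_neg n) / 2 else sqrt_neg n)"
  have O: "ring_of_integers n = {of_int a + of_int b * w | a b. True}"
    by (simp add: ring_of_integers_eq[OF assms] w_def)
  have OI: "of_int a + of_int b * w \<in> ring_of_integers n" for a b
    unfolding O by blast
  obtain t u where w2: "w * w = of_int t + of_int u * w"
  proof (cases "n mod 4 = 3")
    case True
    define m where "m = int (n div 4) + 1"
    have "int n = 4 * m - 1" using True unfolding m_def by presburger
    then have "(of_int (int n) :: complex) = of_int (4 * m - 1)" by (simp only:)
    then have s: "sqrt_neg n * sqrt_neg n = 1 - 4 * of_int m"
      by (simp add: sqrt_neg_square)
    have w: "w = (1 + sqrt_neg n) / 2" using True by (simp add: w_def)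
    have "w * w - w + of_int m = (sqrt_neg n * sqrt_neg n - 1 + 4 * of_int m) / 4"
      unfolding w by (simp add: field_simps)
    then have "w * w = of_int (- m) + of_int 1 * w"
      by (simp add: s algebra_simps)
    then show ?thesis by (rule that)
  next
    case False
    then have "w * w = of_int (- int n) + of_int 0 * w"
      by (simp add: w_def sqrt_neg_square)
    then show ?thesis by (rule that)
  qed
  show ?thesis
    unfolding bianchi_group_def
  proof (rule PSL2_group)
    show "0 \<in> ring_of_integers n" "1 \<in> ring_of_integers n"
      using OI[of 0 0] OI[of 1 0] by simp_all
    fix x assume "x \<in> ring_of_integers n"
    then obtain a b where x: "x = of_int a + of_int b * w" unfolding O by blast
    show "- x \<in> ring_of_integers n"
      using OI[of "- a" "- b"] by (simp add: x)
    fix y assume "y \<in> ring_of_integers n"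
    then obtain c d where y: "y = of_int c + of_int d * w" unfolding O by blast
    show "x + y \<in> ring_of_integers n"
      using OI[of "a + c" "b + d"] by (simp add: x y algebra_simps)
    have "x * y = of_int a * of_int c + (of_int a * of_int d + of_int b * of_int c) * w
        + of_int b * of_int d * (w * w)"
      by (simp add: x y algebra_simps)
    also have "\<dots> = of_int (a * c + b * d * t) + of_int (a * d + b * c + b * d * u) * w"
      unfolding w2 by (simp add: algebra_simps)
    finally show "x * y \<in> ring_of_integers n" by (simp only: OI)
  qed
qed

lemma moebius_quat_j:
  fixes A :: "complex^2^2"
  assumes "det A = 1"
  defines "N \<equiv> (cmod (A $ 2 $ 1))\<^sup>2 + (cmod (A $ 2 $ 2))\<^sup>2"
  shows "N > 0"
    and "moebius A quat_j =
      quat_of_complex ((A $ 1 $ 1 * cnj (A $ 2 $ 1) + A $ 1 $ 2 * cnj (A $ 2 $ 2)) / of_real N)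
      + quat_of_complex (of_real (1 / N)) * quat_j"
proof -
  define a b c d where abcd: "a = A $ 1 $ 1" "b = A $ 1 $ 2" "c = A $ 2 $ 1" "d = A $ 2 $ 2"
  note A = abcd[symmetric]
  have det: "a * d - b * c = 1" using assms(1) by (simp add: det_2 A)
  then have "c \<noteq> 0 \<or> d \<noteq> 0" by auto
  then show N: "N > 0" unfolding N_def A by (auto simp: add_pos_nonneg add_nonneg_pos)
  have N': "N = (Re d)\<^sup>2 + (Im d)\<^sup>2 + (Re c)\<^sup>2 + (Im c)\<^sup>2"
    by (simp add: N_def A cmod_power2)
  define q where "q = quat_of_complex c * quat_j + quat_of_complex d"
  define r where "r = quat_of_complex ((a * cnj c + b * cnj d) / of_real N)
      + quat_of_complex (of_real (1 / N)) * quat_j"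
  have q: "q = Quat (Re d) (Im d) (Re c) (Im c)"
    by (simp add: q_def quat_of_complex_def quat_j_def quat_defs)
  have "q \<noteq> 0" using \<open>c \<noteq> 0 \<or> d \<noteq> 0\<close>
    by (auto simp: q zero_quat_def complex_eq_iff)
  have inv: "inverse q = Quat (Re d / N) (- Im d / N) (- Re c / N) (- Im c / N)"
    by (simp add: inverse_quat_def q N' Let_def)
  have dr: "Re a * Re d - Im a * Im d - (Re b * Re c - Im b * Im c) = 1"
    and di: "Re a * Im d + Im a * Re d - (Re b * Im c + Im b * Re c) = 0"
    using det by (auto simp: complex_eq_iff)
  have "moebius A quat_j = (quat_of_complex a * quat_j + quat_of_complex b) * inverse q"
    by (simp add: moebius_def A q_def divide_inverse)
  also have "\<dots> = r"
    unfolding r_def inv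
  proof (rule quat_eqI, goal_cases)
    case 3
    have "(Re a * Re d - Im a * Im d - (Re b * Re c - Im b * Im c)) / N = 1 / N" using dr by simp
    then show ?case
      by (simp add: quat_of_complex_def quat_j_def quat_defs diff_divide_distrib add_divide_distrib algebra_simps)
  next
    case 4
    have "(Re a * Im d + Im a * Re d - (Re b * Im c + Im b * Re c)) / N = 0" using di by simp
    then show ?case
      by (simp add: quat_of_complex_def quat_j_def quat_defs diff_divide_distrib add_divide_distrib algebra_simps)
  qed (simp_all add: quat_of_complex_def quat_j_def quat_defs diff_divide_distrib add_divide_distrib algebra_simps)
  finally show "moebius A quat_j =
      quat_of_complex ((A $ 1 $ 1 * cnj (A $ 2 $ 1) + A $ 1 $ 2 * cnj (A $ 2 $ 2)) / of_real N)
      + quat_of_complex (of_real (1 / N)) * quat_j"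
    by (simp add: r_def A)
qed

lemma m_tilde_explicit:
  assumes "A \<in> carrier (SL2 UNIV)"
  shows "real_of_int (m_tilde {A, - A})
    = sgn (Im (A $ 1 $ 1 * cnj (A $ 2 $ 1) + A $ 1 $ 2 * cnj (A $ 2 $ 2)))"
proof -
  define N where "N = (cmod (A $ 2 $ 1))\<^sup>2 + (cmod (A $ 2 $ 2))\<^sup>2"
  define w where "w = A $ 1 $ 1 * cnj (A $ 2 $ 1) + A $ 1 $ 2 * cnj (A $ 2 $ 2)"
  have det: "det A = 1" using assms by (simp add: SL2_def)
  have N: "N > 0" and
    act: "psl_act {A, - A} quat_j
      = quat_of_complex (w / of_real N) + quat_of_complex (of_real (1 / N)) * quat_j"
    using moebius_quat_j[OF det] by (simp_all add: psl_act_coset N_def w_def)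
  have "psl_act {A, - A} quat_j \<in> hyp3"
    unfolding act hyp3_def using N by (auto intro!: exI[of _ "w / of_real N"] exI[of _ "1 / N"])
  moreover have "q_i (psl_act {A, - A} quat_j) = Im w / N"
    unfolding act by (simp add: quat_of_complex_def quat_j_def quat_defs)
  ultimately show ?thesis
    using N unfolding w_def[symmetric]
    by (simp add: m_tilde_def Sigma_plus_def Sigma_minus_def sgn_if zero_less_divide_iff divide_less_0_iff)
qed

end

theory Submission
  imports Defs
begin

text \<open>
  Let \<open>P\<close> be the hyperbolic plane \<open>Im \<omega> = 0\<close>, which contains \<open>j\<close>, so that the symbol
  of \<open>g\<close> records the side of \<open>P\<close> on which \<open>g j\<close> lies.  The theorem holds because \<open>P\<close> and its translates
  \<open>g P\<close> by elements of the Bianchi group never cross.  Take a \<open>g\<close> with \<open>g j \<notin> P\<close>.  Then \<open>g P\<close>, which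
  contains \<open>g j\<close>, is disjoint from \<open>P\<close>, and of the two closed half-spaces bounded by \<open>g P\<close> the one
  avoiding \<open>j\<close> lies on the same side of \<open>P\<close> as \<open>g j\<close>.  If the symbols of \<open>h\<close> and
  \<open>g\<inverse>\<close> differ, then \<open>h j\<close> is not strictly on the same side of \<open>P\<close> as \<open>g\<inverse> j\<close>; applying \<open>g\<close>,
  the point \<open>g h j\<close> is in the closed half-space of \<open>g P\<close> avoiding \<open>j\<close>, hence on the same side of \<open>P\<close>
  as \<open>g j\<close>.

  In coordinates, the point \<open>B j\<close> corresponds to the positive definite Hermitian matrix
  \<open>B B\<^sup>*\<close> of determinant 1, and the side of \<open>P\<close> is read off from the imaginary part of its upper right
  entry, here \<open>side B\<close>.  Since \<open>(A B) (A B)\<^sup>* = A (B B\<^sup>*) A\<^sup>*\<close>, the number \<open>side (A ** B)\<close> is a linear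
  form in the entries of \<open>B B\<^sup>*\<close> (\<open>side_mult\<close>), whose coefficients are the coordinates of a normal
  vector of \<open>A\<inverse> P\<close> in Minkowski space.  This vector is a unit vector (\<open>normal_vector_unit\<close>).
  Its component \<open>pairing A\<close> along the normal of \<open>P\<close> has absolute value less than 1 exactly when
  the planes cross.  If it has absolute value at least 1, then the remaining part of the linear form is
  given by a semidefinite quadratic form, so it takes the sign of \<open>side A\<close> at every point (\<open>sgn_side_mult_diff\<close>).
  Finally, for entries in the ring of integers \<open>pairing A\<close> is \<open>1 + \<delta> k\<close> with an integer \<open>k\<close> and
  a constant \<open>\<delta>\<close> that equals \<open>2 n\<close> or, if \<open>n \<equiv> 3\<close> modulo 4, \<open>n / 2\<close>.  For \<open>n \<noteq> 3\<close> this
  \<open>\<delta>\<close> is at least 2, so the absolute value is at least 1 (\<open>abs_pairing_ge_1\<close>).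
  For \<open>n = 3\<close> the value \<open>- 1 / 2\<close> is not ruled out.
\<close>

definition side :: "complex^2^2 \<Rightarrow> real" where
  "side A = Im (A $ 1 $ 1 * cnj (A $ 2 $ 1) + A $ 1 $ 2 * cnj (A $ 2 $ 2))"

text \<open>
  This is the Minkowski inner product of the unit normals of the plane \<open>Im \<omega> = 0\<close> and of its translate
  by \<open>A\<close>; it equals 1 when \<open>A\<close> has real entries and determinant 1.
\<close>
definition pairing :: "complex^2^2 \<Rightarrow> real" where
  "pairing A = Re (A $ 1 $ 1 * cnj (A $ 2 $ 2) - A $ 1 $ 2 * cnj (A $ 2 $ 1))"

lemma side_mult:
  fixes A B :: "complex^2^2"
  defines "w \<equiv> B $ 1 $ 1 * cnj (B $ 2 $ 1) + B $ 1 $ 2 * cnj (B $ 2 $ 2)"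
  shows "side (A ** B) =
      Im (A $ 1 $ 1 * cnj (A $ 2 $ 1)) * ((cmod (B $ 1 $ 1))\<^sup>2 + (cmod (B $ 1 $ 2))\<^sup>2)
    + Im (A $ 1 $ 2 * cnj (A $ 2 $ 2)) * ((cmod (B $ 2 $ 1))\<^sup>2 + (cmod (B $ 2 $ 2))\<^sup>2)
    + Im (A $ 1 $ 1 * cnj (A $ 2 $ 2) - cnj (A $ 1 $ 2) * A $ 2 $ 1) * Re w
    + pairing A * side B"
  unfolding w_def side_def pairing_def cmod_power2
  by (simp add: matrix_matrix_mult_def sum_2 power2_eq_square algebra_simps)

text \<open>
  The coefficients in \<open>side_mult\<close> form a vector of Minkowski norm 1, because the plane
  \<open>Im \<omega> = 0\<close> has a unit normal and \<open>A\<close> acts by isometries.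
\<close>
lemma normal_vector_unit:
  fixes A :: "complex^2^2"
  assumes "det A = 1"
  shows "(pairing A)\<^sup>2 + (Im (A $ 1 $ 1 * cnj (A $ 2 $ 2) - cnj (A $ 1 $ 2) * A $ 2 $ 1))\<^sup>2
    = 1 + 4 * Im (A $ 1 $ 1 * cnj (A $ 2 $ 1)) * Im (A $ 1 $ 2 * cnj (A $ 2 $ 2))"
proof -
  have det: "(cmod (A $ 1 $ 1 * A $ 2 $ 2 - A $ 1 $ 2 * A $ 2 $ 1))\<^sup>2 = 1"
    using assms by (simp add: det_2)
  have "(pairing A)\<^sup>2 + (Im (A $ 1 $ 1 * cnj (A $ 2 $ 2) - cnj (A $ 1 $ 2) * A $ 2 $ 1))\<^sup>2
    = (cmod (A $ 1 $ 1 * A $ 2 $ 2 - A $ 1 $ 2 * A $ 2 $ 1))\<^sup>2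
      + 4 * Im (A $ 1 $ 1 * cnj (A $ 2 $ 1)) * Im (A $ 1 $ 2 * cnj (A $ 2 $ 2))"
    unfolding pairing_def cmod_power2 by (simp add: power2_eq_square algebra_simps)
  then show ?thesis by (simp only: det)
qed

text \<open>
  A semidefinite binary quadratic form with positive trace pairs positively with a
  positive definite one.
\<close>
lemma semidefinite_pairing_pos:
  fixes p q s u v x :: real
  assumes s: "s\<^sup>2 \<le> 4 * p * q" and pq: "p + q > 0"
    and uv: "u > 0" "v > 0" and x: "x\<^sup>2 < u * v"
  shows "p * u + q * v + s * x > 0"
proof -
  have "0 \<le> p * q" using s zero_le_power2[of s] by linarith
  then have nn: "p \<ge> 0" "q \<ge> 0"
    using pq by (auto simp: zero_le_mult_iff)
  show ?thesis
  proof (cases "p * q = 0")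
    case True
    then have "s\<^sup>2 \<le> 0" using s by (simp only: mult.assoc)
    then have "s = 0" by simp
    moreover have "p * u + q * v > 0"
      using nn pq uv True by (cases "p = 0") auto
    ultimately show ?thesis by simp
  next
    case False
    then have pos: "p > 0" "q > 0" using nn by auto
    have "s\<^sup>2 * x\<^sup>2 \<le> 4 * p * q * x\<^sup>2" by (intro mult_right_mono s) simp
    also have "\<dots> < 4 * p * q * (u * v)" using pos x by simp
    finally have "0 < 4 * p * q * (u * v) - s\<^sup>2 * x\<^sup>2" by simp
    also have "\<dots> \<le> (2 * p * u + s * x)\<^sup>2 + 4 * p * q * (u * v) - s\<^sup>2 * x\<^sup>2" by simp
    also have "\<dots> = (4 * p * u) * (p * u + q * v + s * x)"
      by (simp add: power2_eq_square algebra_simps)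
    finally show ?thesis
      by (rule zero_less_mult_pos) (use pos uv in simp)
  qed
qed

text \<open>
  A pairing of absolute value at least 1 makes the part of \<open>side (A ** B)\<close> that does not
  contain \<open>side B\<close> semidefinite, and at \<open>B = mat 1\<close> this part is \<open>side A\<close>.
\<close>
lemma sgn_side_mult_diff:
  fixes A B :: "complex^2^2"
  assumes det: "det A = 1" "det B = 1" and t: "\<bar>pairing A\<bar> \<ge> 1" and ne: "side A \<noteq> 0"
  shows "sgn (side (A ** B) - pairing A * side B) = sgn (side A)"
proof -
  define p where "p = Im (A $ 1 $ 1 * cnj (A $ 2 $ 1))"
  define q where "q = Im (A $ 1 $ 2 * cnj (A $ 2 $ 2))"
  define s where "s = Im (A $ 1 $ 1 * cnj (A $ 2 $ 2) - cnj (A $ 1 $ 2) * A $ 2 $ 1)"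
  define u where "u = (cmod (B $ 1 $ 1))\<^sup>2 + (cmod (B $ 1 $ 2))\<^sup>2"
  define v where "v = (cmod (B $ 2 $ 1))\<^sup>2 + (cmod (B $ 2 $ 2))\<^sup>2"
  define w where "w = B $ 1 $ 1 * cnj (B $ 2 $ 1) + B $ 1 $ 2 * cnj (B $ 2 $ 2)"
  have eq: "side (A ** B) - pairing A * side B = p * u + q * v + s * Re w"
    unfolding side_mult p_def q_def s_def u_def v_def w_def by simp
  have side: "side A = p + q" by (simp add: side_def p_def q_def)
  have "(pairing A)\<^sup>2 \<ge> 1" using power_mono[OF t, of 2] by simp
  then have s: "s\<^sup>2 \<le> 4 * p * q"
    using normal_vector_unit[OF det(1)] unfolding p_def q_def s_def by linarith
  have "u * v = (cmod w)\<^sup>2 + (cmod (det B))\<^sup>2"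
    unfolding u_def v_def w_def det_2 cmod_power2
    by (simp add: power2_eq_square algebra_simps)
  then have uv: "u * v = (Re w)\<^sup>2 + (Im w)\<^sup>2 + 1" by (simp add: det cmod_power2)
  then have x: "(Re w)\<^sup>2 < u * v" using zero_le_power2[of "Im w"] by linarith
  have "u * v > 0" using x zero_le_power2[of "Re w"] by linarith
  moreover have "u \<ge> 0" "v \<ge> 0" by (simp_all add: u_def v_def)
  ultimately have pos: "u > 0" "v > 0" by (auto simp: zero_less_mult_iff)
  show ?thesis
  proof (cases "p + q > 0")
    case True
    with semidefinite_pairing_pos[OF s True pos x] show ?thesis by (simp add: eq side)
  next
    case False
    with ne have neg: "- p + - q > 0" by (simp add: side)
    have "(- s)\<^sup>2 \<le> 4 * (- p) * (- q)" using s by simp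
    from semidefinite_pairing_pos[OF this neg pos x] neg show ?thesis
      by (simp add: eq side sgn_if)
  qed
qed

lemma ring_of_integers_Im:
  assumes "squarefree n"
  shows "\<exists>e. (\<forall>x \<in> ring_of_integers n. \<exists>m::int. Im x = of_int m * e)
    \<and> e\<^sup>2 = (if n mod 4 = 3 then real n / 4 else real n)"
proof -
  let ?e = "if n mod 4 = 3 then sqrt (real n) / 2 else sqrt (real n)"
  have "\<exists>m::int. Im x = of_int m * ?e" if "x \<in> ring_of_integers n" for x
    using that unfolding ring_of_integers_eq[OF assms] by (auto split: if_splits)
  moreover have "?e\<^sup>2 = (if n mod 4 = 3 then real n / 4 else real n)"
    by (simp add: power_divide)
  ultimately show ?thesis by blast
qed

text \<open>
  Since \<open>pairing A\<close> differs from the real part of the determinant by twice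
  \<open>Im a Im d - Im b Im c\<close>, it lies in a coarse translate of a lattice in the reals, which has no
  point between \<open>- 1\<close> and 1.
\<close>
lemma abs_pairing_ge_1:
  assumes n: "n \<ge> 1" "squarefree n" "n \<noteq> 3"
    and A: "A \<in> carrier (SL2 (ring_of_integers n))"
  shows "\<bar>pairing A\<bar> \<ge> 1"
proof -
  obtain e where e: "\<And>x. x \<in> ring_of_integers n \<Longrightarrow> \<exists>m::int. Im x = of_int m * e"
    and e2: "e\<^sup>2 = (if n mod 4 = 3 then real n / 4 else real n)"
    using ring_of_integers_Im[OF n(2)] by blast
  have in_O: "A $ i $ j \<in> ring_of_integers n" for i j using A by (simp add: SL2_def)
  obtain a b c d :: int where im:
    "Im (A $ 1 $ 1) = a * e" "Im (A $ 1 $ 2) = b * e"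
    "Im (A $ 2 $ 1) = c * e" "Im (A $ 2 $ 2) = d * e"
    using e[OF in_O] by metis
  have "A $ 1 $ 1 * A $ 2 $ 2 - A $ 1 $ 2 * A $ 2 $ 1 = 1"
    using A by (simp add: SL2_def det_2)
  then have "Re (A $ 1 $ 1 * A $ 2 $ 2 - A $ 1 $ 2 * A $ 2 $ 1) = 1" by simp
  then have "pairing A = 1 + 2 * (Im (A $ 1 $ 1) * Im (A $ 2 $ 2) - Im (A $ 1 $ 2) * Im (A $ 2 $ 1))"
    by (simp add: pairing_def)
  then have t: "pairing A = 1 + 2 * e\<^sup>2 * of_int (a * d - b * c)"
    by (simp add: im power2_eq_square algebra_simps)
  have "n mod 4 = 3 \<Longrightarrow> n \<ge> 7" using n(3) by presburger
  then have \<delta>: "2 * e\<^sup>2 \<ge> 2" using n(1) by (auto simp: e2)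
  show ?thesis
  proof (cases "a * d - b * c \<ge> 0")
    case True
    then have "(of_int (a * d - b * c) :: real) \<ge> 0" by (simp only: of_int_0_le_iff)
    then have "2 * e\<^sup>2 * of_int (a * d - b * c) \<ge> 0" by (intro mult_nonneg_nonneg) simp_all
    then show ?thesis unfolding t by linarith
  next
    case False
    then have "a * d - b * c \<le> - 1" by linarith
    then have "(of_int (a * d - b * c) :: real) \<le> of_int (- 1)" by (simp only: of_int_le_iff)
    then have "2 * e\<^sup>2 * of_int (a * d - b * c) \<le> 2 * e\<^sup>2 * (- 1)"
      by (intro mult_left_mono) simp_all
    with \<delta> show ?thesis unfolding t by linarith
  qed
qed

lemma m_tilde_eq_sgn_side:
  assumes "det A = 1"
  shows "real_of_int (m_tilde {A, - A}) = sgn (side A)"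
  unfolding side_def using assms by (intro m_tilde_explicit) (simp add: SL2_def)

text \<open>
  The sign of \<open>side C\<close> for an inverse \<open>C\<close> of \<open>A\<close> comes from \<open>sgn_side_mult_diff\<close> as well: since
  \<open>A ** C\<close> fixes \<open>j\<close>, the term \<open>pairing A * side C\<close> has to cancel a number of the sign
  of \<open>side A\<close>.
\<close>
lemma sgn_side_cotlar:
  fixes A B C :: "complex^2^2"
  assumes det: "det A = 1" "det B = 1" "det C = 1"
    and t: "\<bar>pairing A\<bar> \<ge> 1" and ne: "side A \<noteq> 0" and inv: "side (A ** C) = 0"
    and differ: "sgn (side C) \<noteq> sgn (side B)"
  shows "sgn (side (A ** B)) = sgn (side A)"
proof -
  have "- sgn (pairing A) * sgn (side C) = sgn (side A)"
    using sgn_side_mult_diff[OF det(1,3) t ne] inv by (simp add: sgn_mult)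
  then have "sgn (pairing A * side B) = 0 \<or> sgn (pairing A * side B) = sgn (side A)"
    using differ ne unfolding sgn_mult by (auto simp: sgn_if split: if_splits)
  moreover note sgn_side_mult_diff[OF det(1,2) t ne]
  ultimately show ?thesis using ne by (auto simp: sgn_if split: if_splits)
qed

theorem theorem4p3:
  fixes n :: nat
  assumes "n \<ge> 1" and "squarefree n" and "n \<noteq> 3"
  shows "\<forall>g \<in> carrier (bianchi_group n) - K_tilde n. \<forall>h \<in> carrier (bianchi_group n).
    (m_tilde (inv\<^bsub>bianchi_group n\<^esub> g) - m_tilde h) *
    (m_tilde (g \<otimes>\<^bsub>bianchi_group n\<^esub> h) - m_tilde g) = 0"
proof (intro ballI)
  interpret group "bianchi_group n" by (rule bianchi_group_group[OF assms(2)])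
  have rep: "\<exists>A \<in> carrier (SL2 (ring_of_integers n)). x = {A, - A}"
    if "x \<in> carrier (bianchi_group n)" for x
    using that by (auto simp: bianchi_group_def carrier_PSL2)
  fix g h
  assume g: "g \<in> carrier (bianchi_group n) - K_tilde n" and h: "h \<in> carrier (bianchi_group n)"
  obtain A where A: "A \<in> carrier (SL2 (ring_of_integers n))" and gA: "g = {A, - A}"
    using rep g by auto
  obtain B where B: "B \<in> carrier (SL2 (ring_of_integers n))" and hB: "h = {B, - B}"
    using rep[OF h] by auto
  obtain C where C: "C \<in> carrier (SL2 (ring_of_integers n))"
    and gC: "inv\<^bsub>bianchi_group n\<^esub> g = {C, - C}"
    using rep[OF inv_closed] g by auto
  have det: "det A = 1" "det B = 1" "det C = 1" using A B C by (simp_all add: SL2_def)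
  have mult: "g \<otimes>\<^bsub>bianchi_group n\<^esub> h = {A ** B, - (A ** B)}"
    by (simp add: gA hB bianchi_group_def PSL2_mult)
  have "{A ** C, - (A ** C)} = \<one>\<^bsub>bianchi_group n\<^esub>"
    using r_inv[of g] g unfolding gC by (simp add: gA bianchi_group_def PSL2_mult)
  also have "\<dots> = {mat 1, - mat 1}" by (simp add: bianchi_group_def PSL2_def FactGroup_def)
  finally have "A ** C \<in> {mat 1, - mat 1}" by blast
  then have inv: "side (A ** C) = 0" by (auto simp: side_def mat_def)
  have m: "real_of_int (m_tilde g) = sgn (side A)" "real_of_int (m_tilde h) = sgn (side B)"
    "real_of_int (m_tilde (inv\<^bsub>bianchi_group n\<^esub> g)) = sgn (side C)"
    "real_of_int (m_tilde (g \<otimes>\<^bsub>bianchi_group n\<^esub> h)) = sgn (side (A ** B))"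
    unfolding gC mult unfolding gA hB by (simp_all add: m_tilde_eq_sgn_side det det_mul)
  have "m_tilde g \<noteq> 0" using g by (simp add: K_tilde_def)
  then have ne: "side A \<noteq> 0" using m(1) by auto
  show "(m_tilde (inv\<^bsub>bianchi_group n\<^esub> g) - m_tilde h) *
    (m_tilde (g \<otimes>\<^bsub>bianchi_group n\<^esub> h) - m_tilde g) = 0"
  proof (cases "sgn (side C) = sgn (side B)")
    case True
    then show ?thesis using m by simp
  next
    case False
    from sgn_side_cotlar[OF det abs_pairing_ge_1[OF assms A] ne inv this]
    show ?thesis using m by simp
  qed
qed

end
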